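(* Let $\lambda\in\mathbb{R}$, $\lambda\neq1$, and $\gamma=\frac{2}{\lambda-1}$. Let $u$ be a time-dependent velocity field on $S^1$ with $\int_{S^1}u(t,\theta)\,d\theta=\sigma$ constant in time and $u(0,\cdot)=u_0$, and let $\eta$ be its flow. Set $$x(t,\theta)=\eta_\theta(t,\theta)^{1/\gamma},\qquad y(t,\theta)=-\gamma x_\theta(t,\theta)+\sigma x(t,\theta)\int_0^t x(\tau,\theta)^\gamma\,d\tau .$$ Then the equation $$\eta_{tt\theta}=-\frac{\lambda-3}{2}\,\frac{\eta_{t\theta}^2}{\eta_\theta}+\Big[\lambda\sigma(\eta_t-\sigma)+\frac{\lambda-3}{2}E(t)\Big]\eta_\theta,\qquad E(t)=\int_{S^1}u_\theta(t,\theta)^2\,d\theta,$$ is equivalent to the pair of equations $$\frac{\partial^2x}{\partial t^2}(t,\theta)=F(t,\theta)\,x(t,\theta),\qquad \frac{\partial^2y}{\partial t^2}(t,\theta)=F(t,\theta)\,y(t,\theta),$$ where $$F(t,\theta)=\frac{\lambda(\lambda-1)\sigma}{2}\,G(t,\theta)+\frac{(\lambda-1)(\lambda-3)}{4}E(t),$$ with $E$ given in terms of $x$ by $$E(t)=\gamma^2\int_0^1x(t,\phi)^{\gamma-2}x_t(t,\phi)^2\,d\phi,$$ and $G(t,\theta):=\eta_t(t,\theta)-\sigma$ given in terms of $x$ by $$G(t,\theta)=\gamma\int_0^\theta x(t,\phi)^{\gamma-1}x_t(t,\phi)\,d\phi-\gamma\int_0^1x(t,\phi)^\gamma\int_0^\phi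 x(t,\psi)^{\gamma-1}x_t(t,\psi)\,d\psi\,d\phi .$$ The initial conditions are $$x(0,\theta)=1,\quad x_t(0,\theta)=\tfrac1\gamma u_0'(\theta),\qquad y(0,\theta)=0,\quad y_t(0,\theta)=\sigma-u_0''(\theta)=m_0(\theta).$$
   Context: $S^1=\mathbb{R}/\mathbb{Z}$. The flow $\eta$ is defined by $\eta_t(t,\theta)=u(t,\eta(t,\theta))$, $\eta(0,\theta)=\theta$, on a time interval on which $\eta(t,\cdot)$ is an orientation-preserving $C^2$ diffeomorphism of $S^1$ (so $\eta_\theta>0$ and $\int_{S^1}\eta_\theta\,d\theta=1$); here $u(t,\cdot)\in C^2(S^1)$ and $\eta$ is twice differentiable in time as a $C^2$-valued function, so that all displayed derivatives make sense. The third-order equation for $\eta$ is the Lagrangian form of the PDE $m_t+um_\theta+\lambda u_\theta m=0$ with $m=\sigma-u_{\theta\theta}$. *)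

theory Defs
  imports "HOL-Analysis.Analysis"
begin

text \<open>
  Functions on the circle \<open>S\<^sup>1 = \<real>/\<int>\<close> are rendered as 1-periodic functions on the reals, and a
  degree-one map of the circle by a lift \<open>f\<close> with \<open>f (\<theta> + 1) = f \<theta> + 1\<close>. Functions of time and
  space are curried, time first.
\<close>

definition C2 :: "(real \<Rightarrow> real) \<Rightarrow> bool" where
  "C2 f \<longleftrightarrow> f C1_differentiable_on UNIV \<and> deriv f C1_differentiable_on UNIV"

definition C2_circle :: "(real \<Rightarrow> real) \<Rightarrow> bool" where
  "C2_circle f \<longleftrightarrow> C2 f \<and> (\<forall>\<theta>. f (\<theta> + 1) = f \<theta>)"

text \<open>Lifts of orientation-preserving \<open>C\<^sup>2\<close> diffeomorphisms of the circle.\<close>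

definition C2_circle_diffeo :: "(real \<Rightarrow> real) \<Rightarrow> bool" where
  "C2_circle_diffeo f \<longleftrightarrow>
     C2 f \<and> (\<forall>\<theta>. f (\<theta> + 1) = f \<theta> + 1) \<and> bij f \<and> C2 (inv f) \<and> (\<forall>\<theta>. deriv f \<theta> > 0)"

text \<open>
  Time derivatives are taken within the time interval \<open>I\<close>, hence are one-sided at an endpoint of
  \<open>I\<close> that belongs to \<open>I\<close>.
\<close>

definition Dt :: "real set \<Rightarrow> (real \<Rightarrow> real \<Rightarrow> real) \<Rightarrow> real \<Rightarrow> real \<Rightarrow> real" where
  "Dt I f t \<theta> = vector_derivative (\<lambda>s. f s \<theta>) (at t within I)"

definition D\<theta> :: "(real \<Rightarrow> real \<Rightarrow> real) \<Rightarrow> real \<Rightarrow> real \<Rightarrow> real" where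
  "D\<theta> f t \<theta> = deriv (f t) \<theta>"

definition time_differentiable :: "real set \<Rightarrow> (real \<Rightarrow> real \<Rightarrow> real) \<Rightarrow> bool" where
  "time_differentiable I f \<longleftrightarrow> (\<forall>t\<in>I. \<forall>\<theta>. (\<lambda>s. f s \<theta>) differentiable (at t within I))"

text \<open>
  The curve \<open>s \<mapsto> w s\<close> has derivative \<open>v\<close> at \<open>t\<close> in the Banach space \<open>C\<^sup>2(S\<^sup>1)\<close>: the difference
  quotients converge to \<open>v\<close> in the \<open>C\<^sup>2\<close> norm, i.e. uniformly together with their first two space
  derivatives. If \<open>w s\<close> are lifts of circle diffeomorphisms, the curve meant is \<open>s \<mapsto> w s - id\<close>,
  which has the same difference quotients.
\<close>

definition has_C2_derivative ::
    "(real \<Rightarrow> real \<Rightarrow> real) \<Rightarrow> (real \<Rightarrow> real) \<Rightarrow> real \<Rightarrow> real set \<Rightarrow> bool" where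
  "has_C2_derivative w v t I \<longleftrightarrow>
     C2_circle v \<and>
     (\<forall>k\<le>2. uniform_limit UNIV (\<lambda>s. (deriv ^^ k) (\<lambda>\<theta>. (w s \<theta> - w t \<theta>) / (s - t)))
                ((deriv ^^ k) v) (at t within I))"

definition twice_C2_differentiable :: "real set \<Rightarrow> (real \<Rightarrow> real \<Rightarrow> real) \<Rightarrow> bool" where
  "twice_C2_differentiable I w \<longleftrightarrow>
     (\<exists>v a. \<forall>t\<in>I. has_C2_derivative w (v t) t I \<and> has_C2_derivative v (a t) t I)"

definition is_flow :: "real set \<Rightarrow> (real \<Rightarrow> real \<Rightarrow> real) \<Rightarrow> (real \<Rightarrow> real \<Rightarrow> real) \<Rightarrow> bool" where
  "is_flow I u \<eta> \<longleftrightarrow>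
     (\<forall>\<theta>. \<eta> 0 \<theta> = \<theta>) \<and>
     (\<forall>t\<in>I. \<forall>\<theta>. ((\<lambda>s. \<eta> s \<theta>) has_real_derivative u t (\<eta> t \<theta>)) (at t within I))"

end

theory Submission imports Defs begin

text \<open>
  Write \<open>p = \<eta>\<^sub>\<theta>\<close>, \<open>q = \<eta>\<^sub>\<theta>\<^sub>\<theta>\<close>, \<open>v = \<eta>\<^sub>t\<close> and \<open>k = 1 / \<gamma> = (\<lambda> - 1) / 2\<close>, so that \<open>x = p\<^sup>k\<close>.
  Differentiating twice in time gives
  \<open>x\<^sub>t\<^sub>t = k x / p \<sqdot> (p\<^sub>t\<^sub>t + (k - 1) p\<^sub>t\<^sup>2 / p)\<close>. The nonlinearity \<open>p\<^sub>t\<^sup>2 / p\<close> of the third-order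
  equation appears with exactly the coefficient \<open>k - 1 = (\<lambda> - 3) / 2\<close>; this is why \<open>x\<close> is taken
  to be this power of \<open>\<eta>\<^sub>\<theta>\<close>. Hence \<open>x\<^sub>t\<^sub>t = F x\<close> is a pointwise rewriting of the third-order
  equation, and the equation for \<open>y\<close> has to be shown to follow from it.

  For this, \<open>y = x z\<close> with \<open>z = \<sigma> \<integral>\<^sub>0\<^sup>t p d\<tau> - q / p\<close>. Given \<open>x\<^sub>t\<^sub>t = F x\<close>, the equation
  \<open>y\<^sub>t\<^sub>t = F y\<close> says \<open>2 x\<^sub>t z\<^sub>t + x z\<^sub>t\<^sub>t = 0\<close>, that is, that the Wronskian
  \<open>x y\<^sub>t - x\<^sub>t y = x\<^sup>2 z\<^sub>t\<close> does not depend on time. Since \<open>z\<^sub>t = p \<sqdot> (m \<circ> \<eta>)\<close>, this Wronskian is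
  \<open>(m \<circ> \<eta>) \<eta>\<^sub>\<theta>\<^sup>\<lambda>\<close>, the transported momentum of the PDE \<open>m\<^sub>t + u m\<^sub>\<theta> + \<lambda> u\<^sub>\<theta> m = 0\<close>. Its
  conservation is an algebraic consequence of the third-order equation and its \<open>\<theta>\<close>-derivative
  (lemma \<open>momentum_cancellation\<close>). The bracket multiplying \<open>\<eta>\<^sub>\<theta>\<close> cancels there; it
  contributes only through its \<open>\<theta>\<close>-derivative \<open>\<lambda> \<sigma> v\<^sub>\<theta> = \<lambda> \<sigma> p\<^sub>t\<close>, which is free of \<open>E\<close>.

  The formulas for \<open>E\<close> and \<open>G\<close> come from \<open>\<gamma> x\<^sup>\<gamma>\<^sup>-\<^sup>1 x\<^sub>t = p\<^sub>t = v\<^sub>\<theta>\<close> and the change of variables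
  \<open>\<theta> \<mapsto> \<eta>(t, \<theta>)\<close> on the circle (lemma \<open>interval_integral_circle_diffeo\<close>). The function \<open>v\<close> is
  recovered from \<open>v\<^sub>\<theta>\<close> up to a constant, and the mean of \<open>u\<close> fixes it:
  \<open>\<integral> v \<eta>\<^sub>\<theta> d\<theta> = \<integral> u d\<theta> = \<sigma>\<close>.
\<close>

section \<open>Functions on the circle\<close>

lemma C2_has_derivs:
  assumes "C2 f"
  shows "(f has_real_derivative deriv f \<theta>) (at \<theta>)"
    and "(deriv f has_real_derivative deriv (deriv f) \<theta>) (at \<theta>)"
    and "continuous_on S f" and "continuous_on S (deriv f)"
proof -
  have d: "(f has_real_derivative deriv f \<theta>) (at \<theta>)" if "C2 f" for \<theta>
    using that unfolding C2_def C1_differentiable_on_def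
    by (metis DERIV_imp_deriv UNIV_I has_real_derivative_iff_has_vector_derivative)
  have d2: "(deriv f has_real_derivative deriv (deriv f) \<theta>) (at \<theta>)" for \<theta>
    using assms unfolding C2_def C1_differentiable_on_def
    by (metis DERIV_imp_deriv UNIV_I has_real_derivative_iff_has_vector_derivative)
  show "(f has_real_derivative deriv f \<theta>) (at \<theta>)" 
       "(deriv f has_real_derivative deriv (deriv f) \<theta>) (at \<theta>)"
    using d[OF assms] d2 by blast+
  show "continuous_on S f"
    using d[OF assms] by (meson DERIV_continuous_on has_field_derivative_at_within)
  show "continuous_on S (deriv f)"
    using d2 by (meson DERIV_continuous_on has_field_derivative_at_within)
qed

lemma deriv_shift_invariant:
  fixes f :: "real \<Rightarrow> real"
  assumes "\<And>\<theta>. (f has_real_derivative deriv f \<theta>) (at \<theta>)" "\<And>\<theta>. f (\<theta> + 1) = f \<theta> + c"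
  shows "deriv f (\<theta> + 1) = deriv f \<theta>"
proof -
  have "((\<lambda>x. f (x + 1) - c) has_real_derivative deriv f (\<theta> + 1)) (at \<theta>)"
    using assms(1)[of "\<theta> + 1"] by (auto intro!: derivative_eq_intros simp: DERIV_shift)
  then have "(f has_real_derivative deriv f (\<theta> + 1)) (at \<theta>)"
    by (simp add: assms(2))
  then show ?thesis using assms(1) DERIV_unique by blast
qed

lemma interval_integral_FTC_UNIV:
  fixes f F :: "real \<Rightarrow> real" and a b :: real
  assumes "continuous_on UNIV f" "\<And>x. (F has_real_derivative f x) (at x)"
  shows "(LBINT x=a..b. f x) = F b - F a"
  using assms
  by (intro interval_integral_FTC_finite)
     (auto intro: continuous_on_subset has_vector_derivative_at_within
           simp: has_real_derivative_iff_has_vector_derivative)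

text \<open>For an antiderivative \<open>\<Phi>\<close>, the function \<open>c \<mapsto> \<Phi>(c + 1) - \<Phi>(c)\<close> has derivative zero.\<close>

lemma interval_integral_period:
  fixes f :: "real \<Rightarrow> real" and c :: real
  assumes f: "continuous_on UNIV f" and per: "\<And>\<theta>. f (\<theta> + 1) = f \<theta>"
  shows "(LBINT \<theta>=c..c+1. f \<theta>) = (LBINT \<theta>=0..1. f \<theta>)"
proof -
  obtain \<Phi> where \<Phi>: "\<And>x. (\<Phi> has_real_derivative f x) (at x)"
    using einterval_antiderivative[of "-\<infinity>" \<infinity> f] f
    by (auto simp: continuous_on_eq_continuous_at has_real_derivative_iff_has_vector_derivative)
  have "((\<lambda>c. \<Phi> (c + 1) - \<Phi> c) has_real_derivative 0) (at x)" for x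
    using \<Phi>[of "x + 1"] \<Phi>[of x] per[of x]
    by (auto intro!: derivative_eq_intros simp: DERIV_shift)
  then have "\<Phi> (c + 1) - \<Phi> c = \<Phi> (0 + 1) - \<Phi> 0"
    by (intro DERIV_isconst_all) auto
  then show ?thesis
    using interval_integral_FTC_UNIV[OF f \<Phi>, of c "c + 1"]
      interval_integral_FTC_UNIV[OF f \<Phi>, of 0 1]
    by (simp add: zero_ereal_def one_ereal_def)
qed

text \<open>
  Substitution turns the left-hand side into an integral over \<open>[g(0), g(0) + 1]\<close>, which is a
  full period of \<open>f\<close>.
\<close>

lemma interval_integral_circle_diffeo:
  assumes f: "continuous_on UNIV f" "\<And>\<theta>. f (\<theta> + 1) = f \<theta>" and g: "C2_circle_diffeo g"
  shows "(LBINT \<theta>=0..1. f (g \<theta>) * deriv g \<theta>) = (LBINT \<theta>=0..1. f \<theta>)"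
proof -
  have C2: "C2 g" and g1: "g 1 = g 0 + 1"
    using g unfolding C2_circle_diffeo_def by (auto dest: spec[of _ 0])
  have "(LBINT \<theta>=ereal 0..ereal 1. deriv g \<theta> *\<^sub>R f (g \<theta>)) = (LBINT \<theta>=g 0..g 1. f \<theta>)"
    using C2_has_derivs[OF C2] f
    by (intro interval_integral_substitution_finite)
       (auto intro: continuous_on_subset has_field_derivative_at_within)
  then show ?thesis
    using interval_integral_period[OF f, of "g 0"] 
    by (simp add: g1 mult.commute zero_ereal_def one_ereal_def)
qed

section \<open>Derivatives in time\<close>

lemma at_within_interval_neq_bot:
  fixes I :: "real set"
  assumes "is_interval I" "0 \<in> I" "I \<noteq> {0}" "t \<in> I"
  shows "at t within I \<noteq> bot"
proof -
  have "I \<noteq> {x}" for x using assms by auto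
  then have "t islimpt I"
    using assms connected_imp_perfect is_interval_connected by blast
  then show ?thesis by (simp add: trivial_limit_within)
qed

lemma Dt_eqI:
  assumes "at t within I \<noteq> bot" "((\<lambda>s. f s \<theta>) has_real_derivative d) (at t within I)"
  shows "Dt I f t \<theta> = d"
  unfolding Dt_def using assms
  by (intro vector_derivative_within) (auto simp: has_real_derivative_iff_has_vector_derivative)

text \<open>
  Convergence of the difference quotients in the \<open>C\<^sup>2\<close> norm contains the commutation of the time
  derivative with the first two space derivatives: \<open>(w\<^sub>\<theta>)\<^sub>t = v\<^sub>\<theta>\<close> and \<open>(w\<^sub>\<theta>\<^sub>\<theta>)\<^sub>t = v\<^sub>\<theta>\<^sub>\<theta>\<close>.
\<close>

lemma has_C2_derivative_pointwise:
  assumes w: "\<And>s. s \<in> I \<Longrightarrow> C2 (w s)" and t: "t \<in> I" and d: "has_C2_derivative w v t I"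
  shows "((\<lambda>s. w s \<theta>) has_real_derivative v \<theta>) (at t within I)" (is ?A)
    and "((\<lambda>s. deriv (w s) \<theta>) has_real_derivative deriv v \<theta>) (at t within I)" (is ?B)
    and "((\<lambda>s. deriv (deriv (w s)) \<theta>) has_real_derivative deriv (deriv v) \<theta>) (at t within I)" (is ?C)
proof -
  let ?q = "\<lambda>s \<theta>. (w s \<theta> - w t \<theta>) / (s - t)"
  have lim: "((\<lambda>s. (deriv ^^ k) (?q s) \<theta>) \<longlongrightarrow> (deriv ^^ k) v \<theta>) (at t within I)" if "k \<le> 2" for k
    using d that unfolding has_C2_derivative_def by (auto intro: tendsto_uniform_limitI)
  have q1: "deriv (?q s) = (\<lambda>\<theta>. (deriv (w s) \<theta> - deriv (w t) \<theta>) / (s - t))" if "s \<in> I" for s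
    by (intro ext DERIV_imp_deriv DERIV_cdivide DERIV_diff C2_has_derivs w t that)
  have q2: "deriv (deriv (?q s)) \<theta> = (deriv (deriv (w s)) \<theta> - deriv (deriv (w t)) \<theta>) / (s - t)"
    if "s \<in> I" for s
    unfolding q1[OF that]
    by (intro DERIV_imp_deriv DERIV_cdivide DERIV_diff C2_has_derivs w t that)
  show ?A using lim[of 0] by (simp add: has_field_derivative_iff)
  have "((\<lambda>s. (deriv (w s) \<theta> - deriv (w t) \<theta>) / (s - t)) \<longlongrightarrow> deriv v \<theta>) (at t within I)"
    using lim[of 1] q1 by (auto elim!: Lim_transform_eventually simp: eventually_at_filter)
  then show ?B by (simp add: has_field_derivative_iff)
  have "((\<lambda>s. (deriv (deriv (w s)) \<theta> - deriv (deriv (w t)) \<theta>) / (s - t)) 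
      \<longlongrightarrow> deriv (deriv v) \<theta>) (at t within I)"
    using lim[of 2] q2 
    by (auto elim!: Lim_transform_eventually simp: eventually_at_filter numeral_2_eq_2)
  then show ?C by (simp add: has_field_derivative_iff)
qed

text \<open>
  The interval may be unbounded or half-open, and \<open>t\<close> may be one of its endpoints or lie to the
  left of \<open>c\<close>. The proof reduces to a compact subinterval containing \<open>c\<close> and a neighbourhood of
  \<open>t\<close> relative to \<open>I\<close>.
\<close>

lemma interval_integral_FTC_within:
  fixes f :: "real \<Rightarrow> real"
  assumes I: "is_interval I" "c \<in> I" "t \<in> I" and f: "continuous_on I f"
  shows "((\<lambda>u. LBINT x=c..u. f x) has_real_derivative f t) (at t within I)"
proof -
  obtain a where a: "a \<in> I" "a \<le> c" "a \<le> t" "a < t \<or> (\<forall>s\<in>I. t \<le> s)"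
    using I by (metis linorder_le_cases linorder_not_le order_refl order_less_imp_le order_trans)
  obtain b where b: "b \<in> I" "c \<le> b" "t \<le> b" "t < b \<or> (\<forall>s\<in>I. s \<le> t)"
    using I by (metis linorder_le_cases linorder_not_le order_refl order_less_imp_le order_trans)
  have ab: "{a..b} \<subseteq> I"
    using I a b by (meson atLeastAtMost_iff mem_is_interval_1_I subsetI)
  have "((\<lambda>u. LBINT x=c..u. f x) has_vector_derivative f t) (at t within {a..b})"
    using a b ab f by (intro interval_integral_FTC2) (auto intro: continuous_on_subset)
  moreover have "at t within {a..b} = at t within I"
  proof (rule at_within_nhd)
    let ?S = "(if a < t then {a<..} else UNIV) \<inter> (if t < b then {..<b} else UNIV)"
    show "t \<in> ?S" "open ?S" by auto
    show "{a..b} \<inter> ?S - {t} = I \<inter> ?S - {t}"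
      using a b ab by (auto split: if_splits intro: order.antisym)
  qed
  ultimately show ?thesis
    by (simp add: has_real_derivative_iff_has_vector_derivative)
qed

section \<open>The linearising substitution\<close>

text \<open>
  Logarithmic derivatives are kept as factors, so that \<open>x = p\<^sup>k\<close> itself is the only non-rational
  expression and factors out of both derivatives.
\<close>

lemma powr_second_derivative:
  assumes p: "\<And>s. s \<in> I \<Longrightarrow> (p has_real_derivative p1 s) (at s within I)"
    and p1: "\<And>s. s \<in> I \<Longrightarrow> (p1 has_real_derivative p2 s) (at s within I)"
    and pos: "\<And>s. s \<in> I \<Longrightarrow> p s > 0" and t: "t \<in> I"
  shows "((\<lambda>s. p s powr k) has_real_derivative k * (p1 t / p t) * p t powr k) (at t within I)"
    and "((\<lambda>s. k * (p1 s / p s) * p s powr k) has_real_derivative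
           k * ((p2 t + (k - 1) * (p1 t)\<^sup>2 / p t) / p t) * p t powr k) (at t within I)"
proof -
  show x: "((\<lambda>s. p s powr k) has_real_derivative k * (p1 t / p t) * p t powr k) (at t within I)"
    using DERIV_chain2[OF has_real_derivative_powr[OF pos[OF t]] p[OF t], of k] pos[OF t]
    by (simp add: powr_diff mult_ac)
  show "((\<lambda>s. k * (p1 s / p s) * p s powr k) has_real_derivative
           k * ((p2 t + (k - 1) * (p1 t)\<^sup>2 / p t) / p t) * p t powr k) (at t within I)"
    by (rule DERIV_cong[OF DERIV_mult[OF DERIV_cmult[OF DERIV_divide[OF p1[OF t] p[OF t]]] x]])
       (use pos[OF t] in \<open>auto simp: field_simps power2_eq_square\<close>)
qed

text \<open>
  For \<open>p = \<eta>\<^sub>\<theta>\<close>, \<open>q = \<eta>\<^sub>\<theta>\<^sub>\<theta>\<close> and \<open>P = \<integral>\<^sub>0\<^sup>t p d\<tau>\<close> the differentiated function is the quotient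
  \<open>y / x\<close>. Its first derivative is \<open>\<eta>\<^sub>\<theta> \<sqdot> (m \<circ> \<eta>)\<close>: with \<open>p\<^sub>t = (u\<^sub>\<theta> \<circ> \<eta>) p\<close> and
  \<open>q\<^sub>t = (u\<^sub>\<theta>\<^sub>\<theta> \<circ> \<eta>) p\<^sup>2 + (u\<^sub>\<theta> \<circ> \<eta>) q\<close>, the bracket is \<open>(u\<^sub>\<theta>\<^sub>\<theta> \<circ> \<eta>) p\<close>.
\<close>

lemma momentum_quotient_derivatives:
  assumes p: "\<And>s. s \<in> I \<Longrightarrow> (p has_real_derivative p1 s) (at s within I)"
    and p1: "\<And>s. s \<in> I \<Longrightarrow> (p1 has_real_derivative p2 s) (at s within I)"
    and q: "\<And>s. s \<in> I \<Longrightarrow> (q has_real_derivative q1 s) (at s within I)"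
    and q1: "\<And>s. s \<in> I \<Longrightarrow> (q1 has_real_derivative q2 s) (at s within I)"
    and P: "\<And>s. s \<in> I \<Longrightarrow> (P has_real_derivative p s) (at s within I)"
    and pos: "\<And>s. s \<in> I \<Longrightarrow> p s > 0" and t: "t \<in> I"
  shows "((\<lambda>s. \<sigma> * P s - q s / p s) has_real_derivative
           \<sigma> * p t - (q1 t / p t - q t * p1 t / (p t)\<^sup>2)) (at t within I)"
    and "((\<lambda>s. \<sigma> * p s - (q1 s / p s - q s * p1 s / (p s)\<^sup>2)) has_real_derivative
           \<sigma> * p1 t - (q2 t / p t - 2 * q1 t * p1 t / (p t)\<^sup>2 - q t * p2 t / (p t)\<^sup>2
              + 2 * q t * (p1 t)\<^sup>2 / (p t) ^ 3)) (at t within I)"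
proof -
  have nz: "p t \<noteq> 0" using pos[OF t] by auto
  show "((\<lambda>s. \<sigma> * P s - q s / p s) has_real_derivative
           \<sigma> * p t - (q1 t / p t - q t * p1 t / (p t)\<^sup>2)) (at t within I)"
    by (rule derivative_eq_intros p[OF t] q[OF t] P[OF t] refl nz)+
       (use nz in \<open>simp add: field_simps power2_eq_square\<close>)
  have p_sq: "((\<lambda>s. (p s)\<^sup>2) has_real_derivative 2 * p t * p1 t) (at t within I)"
    using DERIV_power[OF p[OF t], of 2] by (simp add: mult_ac)
  have nz2: "(p t)\<^sup>2 \<noteq> 0" using nz by simp
  show "((\<lambda>s. \<sigma> * p s - (q1 s / p s - q s * p1 s / (p s)\<^sup>2)) has_real_derivative
           \<sigma> * p1 t - (q2 t / p t - 2 * q1 t * p1 t / (p t)\<^sup>2 - q t * p2 t / (p t)\<^sup>2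
              + 2 * q t * (p1 t)\<^sup>2 / (p t) ^ 3)) (at t within I)"
    by (rule DERIV_cong[OF DERIV_diff[OF DERIV_cmult[OF p[OF t]] DERIV_diff[OF
          DERIV_divide[OF q1[OF t] p[OF t] nz]
          DERIV_divide[OF DERIV_mult[OF q[OF t] p1[OF t]] p_sq nz2]]]])
       (use nz in \<open>simp add: field_simps power2_eq_square power3_eq_cube\<close>)
qed

text \<open>
  Conservation of momentum, stated as an identity between values at one point. The second and third
  premise are the third-order equation and its \<open>\<theta>\<close>-derivative, with \<open>2 k + 1 = \<lambda>\<close> and \<open>B\<close> the
  bracket multiplying \<open>\<eta>\<^sub>\<theta>\<close>; the conclusion is \<open>2 (x\<^sub>t / x) z\<^sub>t + z\<^sub>t\<^sub>t = 0\<close> for \<open>z = y / x\<close>. The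
  terms with \<open>B\<close> cancel between \<open>q\<^sub>t\<^sub>t / p\<close> and \<open>q p\<^sub>t\<^sub>t / p\<^sup>2\<close>, and \<open>\<lambda>\<close> enters the derivative of
  \<open>B\<close> with just the weight that balances the powers of \<open>p\<close>.
\<close>

lemma momentum_cancellation:
  fixes p p1 p2 q q1 q2 :: real
  assumes "p \<noteq> 0" 
    and "p2 = - (k - 1) * (p1\<^sup>2 / p) + B * p"
    and "q2 = - (k - 1) * (2 * p1 * q1 / p - p1\<^sup>2 * q / p\<^sup>2) + ((2 * k + 1) * \<sigma> * p1 * p + B * q)"
  shows "2 * (k * (p1 / p)) * (\<sigma> * p - (q1 / p - q * p1 / p\<^sup>2))
       + (\<sigma> * p1 - (q2 / p - 2 * q1 * p1 / p\<^sup>2 - q * p2 / p\<^sup>2 + 2 * q * p1\<^sup>2 / p ^ 3)) = 0"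
  unfolding assms(2,3) using assms(1)
  by (simp add: field_simps power2_eq_square power3_eq_cube)

section \<open>Equivalence of the third-order equation and the linear system\<close>

theorem theorem5:
  fixes lam \<gamma> \<sigma> :: real
    and I :: "real set"
    and u \<eta> x y m F Gx :: "real \<Rightarrow> real \<Rightarrow> real"
    and u0 E Ex :: "real \<Rightarrow> real"
  assumes lam: "lam \<noteq> 1"
    and gamma: "\<gamma> = 2 / (lam - 1)"
    and interval: "is_interval I" "0 \<in> I" "I \<noteq> {0}"
    and u_C2: "\<And>t. t \<in> I \<Longrightarrow> C2_circle (u t)"
    and u_mean: "\<And>t. t \<in> I \<Longrightarrow> (LBINT \<theta>=0..1. u t \<theta>) = \<sigma>"
    and u_init: "u 0 = u0"
    and flow: "is_flow I u \<eta>"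
    and diffeo: "\<And>t. t \<in> I \<Longrightarrow> C2_circle_diffeo (\<eta> t)"
    and regular: "twice_C2_differentiable I \<eta>"
    and m_eq: "m = (\<lambda>t \<theta>. \<sigma> - D\<theta> (D\<theta> u) t \<theta>)"
    and E_eq: "E = (\<lambda>t. LBINT \<theta>=0..1. (D\<theta> u t \<theta>)\<^sup>2)"
    and x_eq: "x = (\<lambda>t \<theta>. D\<theta> \<eta> t \<theta> powr (1 / \<gamma>))"
    and y_eq: "y = (\<lambda>t \<theta>. - \<gamma> * D\<theta> x t \<theta> + \<sigma> * x t \<theta> * (LBINT \<tau>=0..t. x \<tau> \<theta> powr \<gamma>))"
    and Ex_eq: "Ex = (\<lambda>t. \<gamma>\<^sup>2 * (LBINT \<phi>=0..1. x t \<phi> powr (\<gamma> - 2) * (Dt I x t \<phi>)\<^sup>2))"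
    and Gx_eq: "Gx = (\<lambda>t \<theta>.
           \<gamma> * (LBINT \<phi>=0..\<theta>. x t \<phi> powr (\<gamma> - 1) * Dt I x t \<phi>)
           - \<gamma> * (LBINT \<phi>=0..1. x t \<phi> powr \<gamma> *
                    (LBINT \<psi>=0..\<phi>. x t \<psi> powr (\<gamma> - 1) * Dt I x t \<psi>)))"
    and F_eq: "F = (\<lambda>t \<theta>. lam * (lam - 1) * \<sigma> / 2 * Gx t \<theta> + (lam - 1) * (lam - 3) / 4 * Ex t)"
  shows
    "((\<forall>t\<in>I. x t differentiable_on UNIV)
     \<and> time_differentiable I x \<and> time_differentiable I (Dt I x)
     \<and> time_differentiable I y \<and> time_differentiable I (Dt I y))
     \<and>
     ((\<forall>t\<in>I. \<forall>\<theta>.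
        D\<theta> (Dt I (Dt I \<eta>)) t \<theta> =
          - ((lam - 3) / 2) * ((D\<theta> (Dt I \<eta>) t \<theta>)\<^sup>2 / D\<theta> \<eta> t \<theta>)
          + (lam * \<sigma> * (Dt I \<eta> t \<theta> - \<sigma>) + (lam - 3) / 2 * E t) * D\<theta> \<eta> t \<theta>)
     \<longleftrightarrow>
     (\<forall>t\<in>I. \<forall>\<theta>. Dt I (Dt I x) t \<theta> = F t \<theta> * x t \<theta>
              \<and> Dt I (Dt I y) t \<theta> = F t \<theta> * y t \<theta>))
     \<and> (\<forall>t\<in>I. E t = Ex t)
     \<and> (\<forall>t\<in>I. \<forall>\<theta>. Dt I \<eta> t \<theta> - \<sigma> = Gx t \<theta>)
     \<and> (\<forall>\<theta>. x 0 \<theta> = 1 \<and> Dt I x 0 \<theta> = 1 / \<gamma> * deriv u0 \<theta>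
        \<and> y 0 \<theta> = 0 \<and> Dt I y 0 \<theta> = \<sigma> - deriv (deriv u0) \<theta>
        \<and> \<sigma> - deriv (deriv u0) \<theta> = m 0 \<theta>)"
proof -
  define k where "k = 1 / \<gamma>"
  have k: "k = (lam - 1) / 2" "\<gamma> * k = 1" "k \<noteq> 0"
    using lam by (auto simp: k_def gamma)
  then have lam_k: "lam = 2 * k + 1" "(lam - 3) / 2 = k - 1"
    by (auto simp: field_simps)
  obtain v a where v: "\<And>t. t \<in> I \<Longrightarrow> has_C2_derivative \<eta> (v t) t I"
    and a: "\<And>t. t \<in> I \<Longrightarrow> has_C2_derivative v (a t) t I"
    using regular unfolding twice_C2_differentiable_def by blast
  note nb = at_within_interval_neq_bot[OF interval]
  define p where "p t \<theta> = deriv (\<eta> t) \<theta>" for t \<theta>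
  define q where "q t \<theta> = deriv (deriv (\<eta> t)) \<theta>" for t \<theta>
  define P where "P t \<theta> = (LBINT \<tau>=0..t. p \<tau> \<theta>)" for t :: real and \<theta>
  define z where "z t \<theta> = \<sigma> * P t \<theta> - q t \<theta> / p t \<theta>" for t \<theta>
  have C2\<eta>: "C2 (\<eta> t)" if "t \<in> I" for t
    using diffeo[OF that] by (simp add: C2_circle_diffeo_def)
  have C2v: "C2 (v t)" if "t \<in> I" for t
    using v[OF that] by (simp add: has_C2_derivative_def C2_circle_def)
  have C2u: "C2 (u t)" if "t \<in> I" for t
    using u_C2[OF that] by (simp add: C2_circle_def)
  have p_pos: "p t \<theta> > 0" if "t \<in> I" for t \<theta>
    using diffeo[OF that] by (simp add: C2_circle_diffeo_def p_def)
  have p_space: "(p t has_real_derivative q t \<theta>) (at \<theta>)" if "t \<in> I" for t \<theta>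
    using C2_has_derivs(2)[OF C2\<eta>[OF that], of \<theta>] by (simp add: p_def[abs_def] q_def)
  have \<eta>_time: "((\<lambda>s. \<eta> s \<theta>) has_real_derivative v t \<theta>) (at t within I)"
    and p_time: "((\<lambda>s. p s \<theta>) has_real_derivative deriv (v t) \<theta>) (at t within I)"
    and q_time: "((\<lambda>s. q s \<theta>) has_real_derivative deriv (deriv (v t)) \<theta>) (at t within I)"
    and v_time: "((\<lambda>s. v s \<theta>) has_real_derivative a t \<theta>) (at t within I)"
    and p1_time: "((\<lambda>s. deriv (v s) \<theta>) has_real_derivative deriv (a t) \<theta>) (at t within I)"
    and q1_time: "((\<lambda>s. deriv (deriv (v s)) \<theta>) has_real_derivative deriv (deriv (a t)) \<theta>) (at t within I)"
    if "t \<in> I" for t \<theta>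
    using has_C2_derivative_pointwise[OF C2\<eta> that v[OF that]]
      has_C2_derivative_pointwise[OF C2v that a[OF that]]
    by (simp_all add: p_def q_def)
  have P_time: "((\<lambda>s. P s \<theta>) has_real_derivative p t \<theta>) (at t within I)" if "t \<in> I" for t \<theta>
    unfolding P_def zero_ereal_def
    by (rule interval_integral_FTC_within[OF interval(1,2) that DERIV_continuous_on[OF p_time]])

  have \<eta>_t: "Dt I \<eta> t = v t" if "t \<in> I" for t
    by (intro ext Dt_eqI nb \<eta>_time that)
  have \<eta>_tt: "Dt I (Dt I \<eta>) t = a t" if "t \<in> I" for t
  proof -
    have "((\<lambda>s. Dt I \<eta> s \<theta>) has_real_derivative a t \<theta>) (at t within I)" for \<theta>
      by (rule has_field_derivative_transform_within[OF v_time[OF that] zero_less_one that])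
         (simp add: \<eta>_t)
    then show ?thesis by (intro ext Dt_eqI nb that)
  qed

  have x: "x t \<theta> = p t \<theta> powr k" for t \<theta>
    by (simp add: x_eq k_def p_def D\<theta>_def)
  have px: "x t \<theta> powr \<gamma> = p t \<theta>" if "t \<in> I" for t \<theta>
    using p_pos[OF that, of \<theta>] k(2) by (simp add: x powr_powr mult.commute)
  have x_time: "((\<lambda>s. x s \<theta>) has_real_derivative k * (deriv (v t) \<theta> / p t \<theta>) * x t \<theta>) (at t within I)"
    if "t \<in> I" for t \<theta>
    unfolding x
    by (intro powr_second_derivative(1)[where ?p2.0 = "\<lambda>s. deriv (a s) \<theta>"] p_time p1_time p_pos that)
  have x_t: "Dt I x t \<theta> = k * (deriv (v t) \<theta> / p t \<theta>) * x t \<theta>" if "t \<in> I" for t \<theta>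
    by (intro Dt_eqI nb x_time that)
  have xt_time: "((\<lambda>s. Dt I x s \<theta>) has_real_derivative
      k * ((deriv (a t) \<theta> + (k - 1) * (deriv (v t) \<theta>)\<^sup>2 / p t \<theta>) / p t \<theta>) * x t \<theta>) (at t within I)"
    if "t \<in> I" for t \<theta>
  proof -
    have "((\<lambda>s. k * (deriv (v s) \<theta> / p s \<theta>) * x s \<theta>) has_real_derivative
        k * ((deriv (a t) \<theta> + (k - 1) * (deriv (v t) \<theta>)\<^sup>2 / p t \<theta>) / p t \<theta>) * x t \<theta>) (at t within I)"
      unfolding x by (intro powr_second_derivative(2) p_time p1_time p_pos that)
    then show ?thesis
      by (rule has_field_derivative_transform_within[OF _ zero_less_one that]) (simp add: x_t)
  qed
  have x_tt: "Dt I (Dt I x) t \<theta> =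
      k * ((deriv (a t) \<theta> + (k - 1) * (deriv (v t) \<theta>)\<^sup>2 / p t \<theta>) / p t \<theta>) * x t \<theta>"
    if "t \<in> I" for t \<theta>
    by (intro Dt_eqI nb xt_time that)
  have x_space: "(x t has_real_derivative k * (q t \<theta> / p t \<theta>) * x t \<theta>) (at \<theta>)" if "t \<in> I" for t \<theta>
    using DERIV_chain2[OF has_real_derivative_powr[OF p_pos[OF that]] p_space[OF that], of k \<theta>]
      p_pos[OF that, of \<theta>]
    by (simp add: x[abs_def] powr_diff mult_ac)

  \<comment> \<open>In \<open>y\<close>, the factor \<open>- \<gamma>\<close> removes the \<open>k\<close> in \<open>x\<^sub>\<theta> = k (q / p) x\<close>, and \<open>x\<^sup>\<gamma> = p\<close>.\<close>
  have y: "y t \<theta> = x t \<theta> * z t \<theta>" if t: "t \<in> I" for t \<theta>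
  proof -
    have "(LBINT \<tau>=0..t. x \<tau> \<theta> powr \<gamma>) = P t \<theta>"
      unfolding P_def
    proof (rule interval_integral_cong)
      fix \<tau> assume "\<tau> \<in> einterval (min 0 (ereal t)) (max 0 (ereal t))"
      then have "\<tau> \<in> I"
        using mem_is_interval_1_I[OF interval(1,2) t, of \<tau>] mem_is_interval_1_I[OF interval(1) t interval(2), of \<tau>]
        by (auto simp: einterval_def min_def max_def zero_ereal_def split: if_splits)
      then show "x \<tau> \<theta> powr \<gamma> = p \<tau> \<theta>"
        using px by blast
    qed
    moreover have "D\<theta> x t \<theta> = k * (q t \<theta> / p t \<theta>) * x t \<theta>"
      unfolding D\<theta>_def using x_space[OF t] by (rule DERIV_imp_deriv)
    ultimately show ?thesis
      using k(2) by (simp add: y_eq z_def algebra_simps)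
  qed
  define z1 where "z1 t \<theta> = \<sigma> * p t \<theta> -
      (deriv (deriv (v t)) \<theta> / p t \<theta> - q t \<theta> * deriv (v t) \<theta> / (p t \<theta>)\<^sup>2)" for t \<theta>
  define z2 where "z2 t \<theta> = \<sigma> * deriv (v t) \<theta> - (deriv (deriv (a t)) \<theta> / p t \<theta>
      - 2 * deriv (deriv (v t)) \<theta> * deriv (v t) \<theta> / (p t \<theta>)\<^sup>2 - q t \<theta> * deriv (a t) \<theta> / (p t \<theta>)\<^sup>2
      + 2 * q t \<theta> * (deriv (v t) \<theta>)\<^sup>2 / (p t \<theta>) ^ 3)" for t \<theta>
  have z_time: "((\<lambda>s. z s \<theta>) has_real_derivative z1 t \<theta>) (at t within I)" if "t \<in> I" for t \<theta>
    unfolding z_def z1_def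
    by (intro momentum_quotient_derivatives(1)[where ?p2.0 = "\<lambda>s. deriv (a s) \<theta>" and
          ?q2.0 = "\<lambda>s. deriv (deriv (a s)) \<theta>"]
        p_time p1_time q_time q1_time P_time p_pos that)
  have z1_time: "((\<lambda>s. z1 s \<theta>) has_real_derivative z2 t \<theta>) (at t within I)" if "t \<in> I" for t \<theta>
    unfolding z1_def z2_def
    by (intro momentum_quotient_derivatives(2)[where P = "\<lambda>s. P s \<theta>"]
        p_time p1_time q_time q1_time P_time p_pos that)
  have y_time: "((\<lambda>s. y s \<theta>) has_real_derivative Dt I x t \<theta> * z t \<theta> + x t \<theta> * z1 t \<theta>) (at t within I)"
    if "t \<in> I" for t \<theta>
    by (rule has_field_derivative_transform_within[OF
          DERIV_cong[OF DERIV_mult[OF x_time[OF that] z_time[OF that]]] zero_less_one that])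
       (simp_all add: y x_t that algebra_simps)
  have y_t: "Dt I y t \<theta> = Dt I x t \<theta> * z t \<theta> + x t \<theta> * z1 t \<theta>" if "t \<in> I" for t \<theta>
    by (intro Dt_eqI nb y_time that)
  have yt_time: "((\<lambda>s. Dt I y s \<theta>) has_real_derivative
      Dt I (Dt I x) t \<theta> * z t \<theta> + 2 * Dt I x t \<theta> * z1 t \<theta> + x t \<theta> * z2 t \<theta>) (at t within I)"
    if "t \<in> I" for t \<theta>
    by (rule has_field_derivative_transform_within[OF
          DERIV_cong[OF DERIV_add[OF DERIV_mult[OF xt_time[OF that] z_time[OF that]]
             DERIV_mult[OF x_time[OF that] z1_time[OF that]]]] zero_less_one that])
       (simp_all add: y_t x_t x_tt that algebra_simps)
  have y_tt: "Dt I (Dt I y) t \<theta> =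
      Dt I (Dt I x) t \<theta> * z t \<theta> + 2 * Dt I x t \<theta> * z1 t \<theta> + x t \<theta> * z2 t \<theta>"
    if "t \<in> I" for t \<theta>
    by (intro Dt_eqI nb yt_time that)

  have v_u: "v t \<theta> = u t (\<eta> t \<theta>)" if "t \<in> I" for t \<theta>
  proof -
    have "Dt I \<eta> t \<theta> = u t (\<eta> t \<theta>)"
      using flow that by (intro Dt_eqI nb) (auto simp: is_flow_def)
    then show ?thesis by (simp add: \<eta>_t that)
  qed
  have v_u_space: "deriv (v t) \<theta> = deriv (u t) (\<eta> t \<theta>) * p t \<theta>" if "t \<in> I" for t \<theta>
  proof -
    have "v t = (\<lambda>\<theta>. u t (\<eta> t \<theta>))" using v_u[OF that] by blast
    then show ?thesis
      unfolding p_def using DERIV_chain2[OF C2_has_derivs(1)[OF C2u] C2_has_derivs(1)[OF C2\<eta>]] that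
      by (simp add: DERIV_imp_deriv)
  qed
  have E: "E t = Ex t" if t: "t \<in> I" for t
  proof -
    \<comment> \<open>Both sides are \<open>v\<^sub>\<theta>\<^sup>2 / \<eta>\<^sub>\<theta>\<close>, since \<open>v\<^sub>\<theta> = (u\<^sub>\<theta> \<circ> \<eta>) \<eta>\<^sub>\<theta>\<close>.\<close>
    have int: "\<gamma>\<^sup>2 * (x t \<phi> powr (\<gamma> - 2) * (Dt I x t \<phi>)\<^sup>2) = (deriv (u t) (\<eta> t \<phi>))\<^sup>2 * deriv (\<eta> t) \<phi>" for \<phi>
    proof -
      have "x t \<phi> powr (\<gamma> - 2) * (x t \<phi>)\<^sup>2 = x t \<phi> powr \<gamma>"
        using p_pos[OF t, of \<phi>] by (simp add: x powr_diff)
      also have "\<dots> = p t \<phi>"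
        using px[OF t] .
      finally have x2: "x t \<phi> powr (\<gamma> - 2) * (x t \<phi>)\<^sup>2 = p t \<phi>" .
      have xt: "\<gamma> * Dt I x t \<phi> = deriv (u t) (\<eta> t \<phi>) * x t \<phi>"
        using p_pos[OF t, of \<phi>] k(2) by (simp add: x_t[OF t] v_u_space[OF t])
      have "\<gamma>\<^sup>2 * (x t \<phi> powr (\<gamma> - 2) * (Dt I x t \<phi>)\<^sup>2) =
          x t \<phi> powr (\<gamma> - 2) * (\<gamma> * Dt I x t \<phi>)\<^sup>2"
        by (simp add: power_mult_distrib)
      also have "\<dots> = (deriv (u t) (\<eta> t \<phi>))\<^sup>2 * (x t \<phi> powr (\<gamma> - 2) * (x t \<phi>)\<^sup>2)"
        unfolding xt by (simp add: power_mult_distrib)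
      finally show ?thesis
        unfolding x2 p_def .
    qed
    have "deriv (u t) (\<theta> + 1) = deriv (u t) \<theta>" for \<theta>
      using u_C2[OF t] C2_has_derivs(1)[OF C2u[OF t]]
      by (intro deriv_shift_invariant[where c = 0]) (auto simp: C2_circle_def)
    then have "(LBINT \<phi>=0..1. (deriv (u t) (\<eta> t \<phi>))\<^sup>2 * deriv (\<eta> t) \<phi>) = (LBINT \<phi>=0..1. (deriv (u t) \<phi>)\<^sup>2)"
      using C2_has_derivs(4)[OF C2u[OF t]]
      by (intro interval_integral_circle_diffeo diffeo t) (auto intro!: continuous_intros)
    then show ?thesis
      unfolding E_eq Ex_eq D\<theta>_def by (simp add: interval_lebesgue_integral_mult_right[symmetric] int)
  qed
  have G: "v t \<theta> - \<sigma> = Gx t \<theta>" if t: "t \<in> I" for t \<theta>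
  proof -
    have int: "\<gamma> * (x t \<phi> powr (\<gamma> - 1) * Dt I x t \<phi>) = deriv (v t) \<phi>" for \<phi>
    proof -
      have "x t \<phi> powr (\<gamma> - 1) * x t \<phi> = x t \<phi> powr \<gamma>"
        using p_pos[OF t, of \<phi>] by (simp add: x powr_diff)
      also have "\<dots> = p t \<phi>"
        using px[OF t] .
      finally have x1: "x t \<phi> powr (\<gamma> - 1) * x t \<phi> = p t \<phi>" .
      have "\<gamma> * (x t \<phi> powr (\<gamma> - 1) * Dt I x t \<phi>) =
          (\<gamma> * k) * (deriv (v t) \<phi> / p t \<phi>) * (x t \<phi> powr (\<gamma> - 1) * x t \<phi>)"
        unfolding x_t[OF t] by (simp only: mult_ac)
      then show ?thesis
        unfolding x1 using p_pos[OF t, of \<phi>] k(2) by simp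
    qed
    have inner: "\<gamma> * (LBINT \<phi>=0..\<theta>. x t \<phi> powr (\<gamma> - 1) * Dt I x t \<phi>) = v t \<theta> - v t 0" for \<theta> :: real
      using interval_integral_FTC_UNIV[OF C2_has_derivs(4,1)[OF C2v[OF t]], of 0 \<theta>]
      by (simp add: interval_lebesgue_integral_mult_right[symmetric] int zero_ereal_def)
    have "\<gamma> * (LBINT \<phi>=0..1. x t \<phi> powr \<gamma> *
                    (LBINT \<psi>=0..\<phi>. x t \<psi> powr (\<gamma> - 1) * Dt I x t \<psi>))
        = (LBINT \<phi>=0..1. x t \<phi> powr \<gamma> * 
             (\<gamma> * (LBINT \<psi>=0..\<phi>. x t \<psi> powr (\<gamma> - 1) * Dt I x t \<psi>)))"
      unfolding interval_lebesgue_integral_mult_right[symmetric] by (simp add: mult_ac)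
    \<comment> \<open>The weight \<open>x\<^sup>\<gamma> = \<eta>\<^sub>\<theta>\<close> is the Jacobian of the flow, and \<open>v = u \<circ> \<eta>\<close>.\<close>
    also have "\<dots> = (LBINT \<phi>=0..1. (u t (\<eta> t \<phi>) - v t 0) * deriv (\<eta> t) \<phi>)"
      unfolding inner px[OF t] v_u[OF t] p_def by (simp only: mult.commute)
    also have "\<dots> = (LBINT \<phi>=0..1. u t \<phi> - v t 0)"
      using u_C2[OF t] C2_has_derivs(3)[OF C2u[OF t]]
      by (intro interval_integral_circle_diffeo diffeo t)
         (auto intro!: continuous_intros simp: C2_circle_def)
    also have "\<dots> = (LBINT \<phi>=0..1. u t \<phi>) - (LBINT \<phi>=0..1. v t 0)"
      using C2_has_derivs(3)[OF C2u[OF t]]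
      by (intro interval_lebesgue_integral_diff(2))
         (auto simp: zero_ereal_def one_ereal_def intro!: interval_integrable_continuous_on)
    also have "\<dots> = \<sigma> - v t 0"
      using u_mean[OF t] by (simp add: zero_ereal_def one_ereal_def)
    finally show ?thesis
      unfolding Gx_eq inner by simp
  qed

  have F: "F t \<theta> = k * (lam * \<sigma> * (v t \<theta> - \<sigma>) + (lam - 3) / 2 * E t)" if "t \<in> I" for t \<theta>
    unfolding F_eq G[OF that, symmetric] E[OF that, symmetric] k(1) by (simp add: field_simps)
  let ?rhs = "\<lambda>t \<theta>. - ((lam - 3) / 2) * ((deriv (v t) \<theta>)\<^sup>2 / p t \<theta>)
     + (lam * \<sigma> * (v t \<theta> - \<sigma>) + (lam - 3) / 2 * E t) * p t \<theta>"
  have x_iff: "Dt I (Dt I x) t \<theta> = F t \<theta> * x t \<theta> \<longleftrightarrow> deriv (a t) \<theta> = ?rhs t \<theta>" if t: "t \<in> I" for t \<theta>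
  proof -
    have nz: "x t \<theta> \<noteq> 0" "p t \<theta> \<noteq> 0"
      using p_pos[OF t, of \<theta>] by (simp_all add: x)
    have "Dt I (Dt I x) t \<theta> = F t \<theta> * x t \<theta> \<longleftrightarrow>
        (deriv (a t) \<theta> + (k - 1) * (deriv (v t) \<theta>)\<^sup>2 / p t \<theta>) / p t \<theta> =
          lam * \<sigma> * (v t \<theta> - \<sigma>) + (lam - 3) / 2 * E t"
      unfolding x_tt[OF t] F[OF t]
      by (simp only: mult_right_cancel[OF nz(1)] mult_left_cancel[OF k(3)])
    also have "\<dots> \<longleftrightarrow> deriv (a t) \<theta> = ?rhs t \<theta>"
      unfolding lam_k(2) using nz(2) by (simp add: field_simps)
    finally show ?thesis .
  qed
  have y_tt_F: "Dt I (Dt I y) t \<theta> = F t \<theta> * y t \<theta>" 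
    if t: "t \<in> I" and A: "\<And>\<theta>. deriv (a t) \<theta> = ?rhs t \<theta>" for t \<theta>
  proof -
    let ?B = "lam * \<sigma> * (v t \<theta> - \<sigma>) + (lam - 3) / 2 * E t"
    have nz: "p t \<theta> \<noteq> 0" using p_pos[OF t, of \<theta>] by simp
    have v1: "(deriv (v t) has_real_derivative deriv (deriv (v t)) \<theta>) (at \<theta>)"
      and v0: "(v t has_real_derivative deriv (v t) \<theta>) (at \<theta>)"
      using C2_has_derivs[OF C2v[OF t]] by blast+
    \<comment> \<open>The equation holds for all \<open>\<theta>\<close> at the fixed time \<open>t\<close>, so it may be differentiated in \<open>\<theta>\<close>.\<close>
    have "deriv (a t) = (\<lambda>\<theta>. ?rhs t \<theta>)"
      using A by blast
    moreover have "((\<lambda>\<theta>. ?rhs t \<theta>) has_real_derivative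
        - (k - 1) * (2 * deriv (v t) \<theta> * deriv (deriv (v t)) \<theta> / p t \<theta> - (deriv (v t) \<theta>)\<^sup>2 * q t \<theta> / (p t \<theta>)\<^sup>2)
        + ((2 * k + 1) * \<sigma> * deriv (v t) \<theta> * p t \<theta> + ?B * q t \<theta>)) (at \<theta>)"
      by (rule DERIV_cong[OF DERIV_add[OF
            DERIV_cmult[OF DERIV_divide[OF DERIV_power[OF v1] p_space[OF t] nz]]
            DERIV_mult[OF DERIV_add[OF DERIV_cmult[OF DERIV_diff[OF v0 DERIV_const]] DERIV_const]
              p_space[OF t]]]])
         (use nz in \<open>simp add: lam_k field_simps power2_eq_square\<close>)
    ultimately have a2: "deriv (deriv (a t)) \<theta> =
        - (k - 1) * (2 * deriv (v t) \<theta> * deriv (deriv (v t)) \<theta> / p t \<theta> - (deriv (v t) \<theta>)\<^sup>2 * q t \<theta> / (p t \<theta>)\<^sup>2)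
        + ((2 * k + 1) * \<sigma> * deriv (v t) \<theta> * p t \<theta> + ?B * q t \<theta>)"
      by (simp only: DERIV_imp_deriv)
    have "2 * (k * (deriv (v t) \<theta> / p t \<theta>)) * z1 t \<theta> + z2 t \<theta> = 0"
      unfolding z1_def z2_def
      by (rule momentum_cancellation[OF nz A[of \<theta>, unfolded lam_k(2)] a2[unfolded lam_k(2)]])
    moreover have "2 * Dt I x t \<theta> * z1 t \<theta> + x t \<theta> * z2 t \<theta> =
        x t \<theta> * (2 * (k * (deriv (v t) \<theta> / p t \<theta>)) * z1 t \<theta> + z2 t \<theta>)"
      by (simp add: x_t[OF t] algebra_simps)
    ultimately have "2 * Dt I x t \<theta> * z1 t \<theta> + x t \<theta> * z2 t \<theta> = 0"
      by simp
    moreover have "Dt I (Dt I x) t \<theta> = F t \<theta> * x t \<theta>"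
      using A x_iff[OF t] by blast
    ultimately show ?thesis
      by (simp add: y_tt[OF t] y[OF t])
  qed

  have init: "\<eta> 0 = (\<lambda>\<theta>. \<theta>)"
    using flow unfolding is_flow_def by blast
  have p0: "p 0 \<theta> = 1" and q0: "q 0 \<theta> = 0" and P0: "P 0 \<theta> = 0" for \<theta>
    by (simp_all add: p_def q_def P_def init zero_ereal_def)
  have v0: "v 0 = u0"
    using v_u[OF interval(2)] u_init init by auto
  show ?thesis
  proof (intro conjI ballI allI)
    show "x t differentiable_on UNIV" if "t \<in> I" for t
      using x_space[OF that] by (meson differentiable_on_def real_differentiable_def)
    show "time_differentiable I x" "time_differentiable I (Dt I x)"
         "time_differentiable I y" "time_differentiable I (Dt I y)"
      unfolding time_differentiable_def
      using x_time xt_time y_time yt_time by (meson real_differentiable_def)+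
    show "(\<forall>t\<in>I. \<forall>\<theta>.
        D\<theta> (Dt I (Dt I \<eta>)) t \<theta> =
          - ((lam - 3) / 2) * ((D\<theta> (Dt I \<eta>) t \<theta>)\<^sup>2 / D\<theta> \<eta> t \<theta>)
          + (lam * \<sigma> * (Dt I \<eta> t \<theta> - \<sigma>) + (lam - 3) / 2 * E t) * D\<theta> \<eta> t \<theta>)
     \<longleftrightarrow>
     (\<forall>t\<in>I. \<forall>\<theta>. Dt I (Dt I x) t \<theta> = F t \<theta> * x t \<theta>
              \<and> Dt I (Dt I y) t \<theta> = F t \<theta> * y t \<theta>)" (is "?L = ?R")
    proof -
      have "?L \<longleftrightarrow> (\<forall>t\<in>I. \<forall>\<theta>. deriv (a t) \<theta> = ?rhs t \<theta>)"
        by (simp add: D\<theta>_def \<eta>_t \<eta>_tt p_def)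
      also have "\<dots> \<longleftrightarrow> ?R"
        using x_iff y_tt_F by blast
      finally show ?thesis .
    qed
    show "E t = Ex t" if "t \<in> I" for t using E that .
    show "Dt I \<eta> t \<theta> - \<sigma> = Gx t \<theta>" if "t \<in> I" for t \<theta> using G that \<eta>_t by simp
    fix \<theta>
    show "x 0 \<theta> = 1" by (simp add: x p0)
    show "Dt I x 0 \<theta> = 1 / \<gamma> * deriv u0 \<theta>"
      by (simp add: x_t[OF interval(2)] x p0 v0 k_def)
    show "y 0 \<theta> = 0" by (simp add: y[OF interval(2)] z_def p0 q0 P0)
    show "Dt I y 0 \<theta> = \<sigma> - deriv (deriv u0) \<theta>"
      by (simp add: y_t[OF interval(2)] x p0 z_def z1_def q0 P0 v0)
    show "\<sigma> - deriv (deriv u0) \<theta> = m 0 \<theta>"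
      by (simp add: m_eq D\<theta>_def[abs_def] u_init)
  qed
qed

end
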